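(* The functor $\check{C}:\mathbf{Cl}\to\mathbf{Simp}$ has neither a right adjoint nor a left adjoint.
   Context: A (Čech) closure space $(X,c)$ is a set $X$ with a function $c:2^X\to 2^X$ such that $c(\varnothing)=\varnothing$, $A\subset c(A)$, and $c(A\cup B)=c(A)\cup c(B)$. Write $c(x)$ for $c(\{x\})$. Continuous maps $f:(X,c_X)\to(Y,c_Y)$ satisfy $f(c_X(A))\subset c_Y(f(A))$ for all $A$; $\mathbf{Cl}$ is the resulting category. A simplicial complex $(X,E)$ is a set $X$ with a collection $E$ of nonempty finite subsets of $X$ containing all singletons and closed under nonempty subsets; a simplicial map $f:(X,E)\to(Y,F)$ is a map with $f(\sigma)\in F$ for all $\sigma\in E$; $\mathbf{Simp}$ is the resulting category. The Čech functor $\check{C}:\mathbf{Cl}\to\mathbf{Simp}$ sends $(X,c)$ to $(X,\check{C}(c))$, where $\check{C}(c)$ is the set of nonempty finite $\sigma\subset X$ such that $\sigma\subset c(x)$ for some $x\in X$, and is the identity on underlying set maps. *)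

theory Defs
  imports "HOL-Library.FuncSet"
begin

text \<open>
  Hom-sets are indexed by source and target and need not be disjoint; accordingly composition
  and the action of a functor on morphisms take the objects involved as arguments:
  \<open>comp C X Y Z g f\<close> is the composite of \<open>f : X \<rightarrow> Y\<close> and \<open>g : Y \<rightarrow> Z\<close>.
\<close>

record ('o, 'm) cat =
  obj :: "'o set"
  hom :: "'o \<Rightarrow> 'o \<Rightarrow> 'm set"
  ident :: "'o \<Rightarrow> 'm"
  comp :: "'o \<Rightarrow> 'o \<Rightarrow> 'o \<Rightarrow> 'm \<Rightarrow> 'm \<Rightarrow> 'm"

locale category =
  fixes C :: "('o, 'm) cat"
  assumes ident_in_hom: "X \<in> obj C \<Longrightarrow> ident C X \<in> hom C X X"
    and comp_in_hom:
      "\<lbrakk>X \<in> obj C; Y \<in> obj C; Z \<in> obj C; f \<in> hom C X Y; g \<in> hom C Y Z\<rbrakk>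
        \<Longrightarrow> comp C X Y Z g f \<in> hom C X Z"
    and comp_ident_right:
      "\<lbrakk>X \<in> obj C; Y \<in> obj C; f \<in> hom C X Y\<rbrakk> \<Longrightarrow> comp C X X Y f (ident C X) = f"
    and comp_ident_left:
      "\<lbrakk>X \<in> obj C; Y \<in> obj C; f \<in> hom C X Y\<rbrakk> \<Longrightarrow> comp C X Y Y (ident C Y) f = f"
    and comp_assoc:
      "\<lbrakk>W \<in> obj C; X \<in> obj C; Y \<in> obj C; Z \<in> obj C;
        f \<in> hom C W X; g \<in> hom C X Y; h \<in> hom C Y Z\<rbrakk>
        \<Longrightarrow> comp C W X Z (comp C X Y Z h g) f = comp C W Y Z h (comp C W X Y g f)"

record ('o, 'm, 'p, 'n) funct =
  fobj :: "'o \<Rightarrow> 'p"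
  fmor :: "'o \<Rightarrow> 'o \<Rightarrow> 'm \<Rightarrow> 'n"

locale category_functor =
  source: category C + target: category D
  for C :: "('o, 'm) cat" and D :: "('p, 'n) cat" +
  fixes F :: "('o, 'm, 'p, 'n) funct"
  assumes fobj_in_obj: "X \<in> obj C \<Longrightarrow> fobj F X \<in> obj D"
    and fmor_in_hom:
      "\<lbrakk>X \<in> obj C; Y \<in> obj C; f \<in> hom C X Y\<rbrakk>
        \<Longrightarrow> fmor F X Y f \<in> hom D (fobj F X) (fobj F Y)"
    and fmor_ident: "X \<in> obj C \<Longrightarrow> fmor F X X (ident C X) = ident D (fobj F X)"
    and fmor_comp:
      "\<lbrakk>X \<in> obj C; Y \<in> obj C; Z \<in> obj C; f \<in> hom C X Y; g \<in> hom C Y Z\<rbrakk>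
        \<Longrightarrow> fmor F X Z (comp C X Y Z g f) =
            comp D (fobj F X) (fobj F Y) (fobj F Z) (fmor F Y Z g) (fmor F X Y f)"

text \<open>
  \<open>F : C \<rightarrow> D\<close> is left adjoint to \<open>G : D \<rightarrow> C\<close>, witnessed by bijections
  \<open>hom D (F X) Y \<cong> hom C X (G Y)\<close> natural in both variables.
\<close>

locale adjunction =
  left: category_functor C D F + right: category_functor D C G
  for C :: "('o, 'm) cat" and D :: "('p, 'n) cat"
    and F :: "('o, 'm, 'p, 'n) funct" and G :: "('p, 'n, 'o, 'm) funct" +
  fixes \<phi> :: "'o \<Rightarrow> 'p \<Rightarrow> 'n \<Rightarrow> 'm"
  assumes bij:
      "\<lbrakk>X \<in> obj C; Y \<in> obj D\<rbrakk>
        \<Longrightarrow> bij_betw (\<phi> X Y) (hom D (fobj F X) Y) (hom C X (fobj G Y))"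
    and natural_left:
      "\<lbrakk>X \<in> obj C; X' \<in> obj C; Y \<in> obj D; h \<in> hom C X' X; f \<in> hom D (fobj F X) Y\<rbrakk>
        \<Longrightarrow> \<phi> X' Y (comp D (fobj F X') (fobj F X) Y f (fmor F X' X h)) =
            comp C X' X (fobj G Y) (\<phi> X Y f) h"
    and natural_right:
      "\<lbrakk>X \<in> obj C; Y \<in> obj D; Y' \<in> obj D; k \<in> hom D Y Y'; f \<in> hom D (fobj F X) Y\<rbrakk>
        \<Longrightarrow> \<phi> X Y' (comp D (fobj F X) Y Y' k f) =
            comp C X (fobj G Y) (fobj G Y') (fmor G Y Y' k) (\<phi> X Y f)"

definition has_right_adjoint ::
    "('o, 'm) cat \<Rightarrow> ('p, 'n) cat \<Rightarrow> ('o, 'm, 'p, 'n) funct \<Rightarrow> bool" where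
  "has_right_adjoint C D F \<longleftrightarrow> (\<exists>G \<phi>. adjunction C D F G \<phi>)"

definition has_left_adjoint ::
    "('o, 'm) cat \<Rightarrow> ('p, 'n) cat \<Rightarrow> ('o, 'm, 'p, 'n) funct \<Rightarrow> bool" where
  "has_left_adjoint C D F \<longleftrightarrow> (\<exists>L \<phi>. adjunction D C L F \<phi>)"


text \<open>
  Closure operators and maps are extensional (\<open>undefined\<close> outside \<open>Pow X\<close> and \<open>X\<close>
  respectively), so that equality of objects and of morphisms is the usual one.
\<close>

definition closure_space :: "'u set \<Rightarrow> ('u set \<Rightarrow> 'u set) \<Rightarrow> bool" where
  "closure_space X c \<longleftrightarrow>
     c \<in> Pow X \<rightarrow>\<^sub>E Pow X \<and>
     c {} = {} \<and>
     (\<forall>A. A \<subseteq> X \<longrightarrow> A \<subseteq> c A) \<and>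
     (\<forall>A B. A \<subseteq> X \<longrightarrow> B \<subseteq> X \<longrightarrow> c (A \<union> B) = c A \<union> c B)"

definition continuous_maps ::
    "'u set \<Rightarrow> ('u set \<Rightarrow> 'u set) \<Rightarrow> 'u set \<Rightarrow> ('u set \<Rightarrow> 'u set) \<Rightarrow> ('u \<Rightarrow> 'u) set" where
  "continuous_maps X c Y d = {f \<in> X \<rightarrow>\<^sub>E Y. \<forall>A. A \<subseteq> X \<longrightarrow> f ` c A \<subseteq> d (f ` A)}"

definition simplicial_complex :: "'u set \<Rightarrow> 'u set set \<Rightarrow> bool" where
  "simplicial_complex X E \<longleftrightarrow>
     (\<forall>\<sigma>\<in>E. \<sigma> \<noteq> {} \<and> finite \<sigma> \<and> \<sigma> \<subseteq> X) \<and>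
     (\<forall>x\<in>X. {x} \<in> E) \<and>
     (\<forall>\<sigma>\<in>E. \<forall>\<tau>. \<tau> \<noteq> {} \<longrightarrow> \<tau> \<subseteq> \<sigma> \<longrightarrow> \<tau> \<in> E)"

definition simplicial_maps ::
    "'u set \<Rightarrow> 'u set set \<Rightarrow> 'u set \<Rightarrow> 'u set set \<Rightarrow> ('u \<Rightarrow> 'u) set" where
  "simplicial_maps X E Y F = {f \<in> X \<rightarrow>\<^sub>E Y. \<forall>\<sigma>\<in>E. f ` \<sigma> \<in> F}"

text \<open>
  The categories are formed relative to a collection \<open>U\<close> of admissible underlying sets, playing
  the role of the universe of small sets.
\<close>

definition Cl :: "'u set set \<Rightarrow> ('u set \<times> ('u set \<Rightarrow> 'u set), 'u \<Rightarrow> 'u) cat" where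
  "Cl U = \<lparr>obj = {(X, c). X \<in> U \<and> closure_space X c},
           hom = (\<lambda>(X, c) (Y, d). continuous_maps X c Y d),
           ident = (\<lambda>(X, c). \<lambda>x\<in>X. x),
           comp = (\<lambda>(X, c) _ _ g f. compose X g f)\<rparr>"

definition Simp :: "'u set set \<Rightarrow> ('u set \<times> 'u set set, 'u \<Rightarrow> 'u) cat" where
  "Simp U = \<lparr>obj = {(X, E). X \<in> U \<and> simplicial_complex X E},
             hom = (\<lambda>(X, E) (Y, F). simplicial_maps X E Y F),
             ident = (\<lambda>(X, E). \<lambda>x\<in>X. x),
             comp = (\<lambda>(X, E) _ _ g f. compose X g f)\<rparr>"

definition cech_complex :: "'u set \<Rightarrow> ('u set \<Rightarrow> 'u set) \<Rightarrow> 'u set set" where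
  "cech_complex X c = {\<sigma>. \<sigma> \<noteq> {} \<and> finite \<sigma> \<and> \<sigma> \<subseteq> X \<and> (\<exists>x\<in>X. \<sigma> \<subseteq> c {x})}"

definition Cech ::
    "('u set \<times> ('u set \<Rightarrow> 'u set), 'u \<Rightarrow> 'u, 'u set \<times> 'u set set, 'u \<Rightarrow> 'u) funct" where
  "Cech = \<lparr>fobj = (\<lambda>(X, c). (X, cech_complex X c)), fmor = (\<lambda>_ _ f. f)\<rparr>"


lemma closure_subset:
  assumes "closure_space X c" "A \<subseteq> X"
  shows "c A \<subseteq> X"
proof -
  have "c \<in> Pow X \<rightarrow>\<^sub>E Pow X" using assms(1) unfolding closure_space_def by (rule conjunct1)
  then have "c A \<in> Pow X" by (rule PiE_mem) (simp add: assms(2))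
  then show ?thesis by simp
qed

lemma continuous_maps_PiE: "f \<in> continuous_maps X c Y d \<Longrightarrow> f \<in> X \<rightarrow>\<^sub>E Y"
  unfolding continuous_maps_def by blast

lemma simplicial_maps_PiE: "f \<in> simplicial_maps X E Y F \<Longrightarrow> f \<in> X \<rightarrow>\<^sub>E Y"
  unfolding simplicial_maps_def by blast

lemma compose_continuous_maps:
  assumes "closure_space X c"
    and f: "f \<in> continuous_maps X c Y d" and g: "g \<in> continuous_maps Y d Z e"
  shows "compose X g f \<in> continuous_maps X c Z e"
proof -
  have fX: "f \<in> X \<rightarrow> Y" and gY: "g \<in> Y \<rightarrow> Z"
    using continuous_maps_PiE[OF f] continuous_maps_PiE[OF g] by (simp_all add: PiE_def)
  have "compose X g f ` c A \<subseteq> e (compose X g f ` A)" if A: "A \<subseteq> X" for A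
  proof -
    have "c A \<subseteq> X" using closure_subset[OF assms(1) A] .
    hence "compose X g f ` c A = g ` (f ` c A)" and "compose X g f ` A = g ` (f ` A)"
      using A by (force simp: compose_def)+
    moreover have "f ` c A \<subseteq> d (f ` A)" using f A by (simp add: continuous_maps_def)
    hence "g ` f ` c A \<subseteq> g ` d (f ` A)" by (rule image_mono)
    moreover have "f ` A \<subseteq> Y" using fX A by auto
    hence "g ` d (f ` A) \<subseteq> e (g ` f ` A)" using g by (simp add: continuous_maps_def)
    ultimately show ?thesis by simp
  qed
  moreover have "compose X g f \<in> X \<rightarrow>\<^sub>E Z"
    using fX gY by (auto simp: compose_def)
  ultimately show ?thesis by (simp add: continuous_maps_def)
qed

lemma compose_simplicial_maps:
  assumes "simplicial_complex X E"
    and f: "f \<in> simplicial_maps X E Y F" and g: "g \<in> simplicial_maps Y F Z G"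
  shows "compose X g f \<in> simplicial_maps X E Z G"
proof -
  have fX: "f \<in> X \<rightarrow> Y" and gY: "g \<in> Y \<rightarrow> Z"
    using simplicial_maps_PiE[OF f] simplicial_maps_PiE[OF g] by (simp_all add: PiE_def)
  have "compose X g f ` \<sigma> \<in> G" if s: "\<sigma> \<in> E" for \<sigma>
  proof -
    have "\<sigma> \<subseteq> X" using assms(1) s by (auto simp: simplicial_complex_def)
    hence "compose X g f ` \<sigma> = g ` (f ` \<sigma>)" by (force simp: compose_def)
    thus ?thesis using f g s by (auto simp: simplicial_maps_def)
  qed
  moreover have "compose X g f \<in> X \<rightarrow>\<^sub>E Z"
    using fX gY by (auto simp: compose_def)
  ultimately show ?thesis by (simp add: simplicial_maps_def)
qed

lemma restrict_id_continuous:
  assumes "closure_space X c"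
  shows "(\<lambda>x\<in>X. x) \<in> continuous_maps X c X c"
proof -
  have "(\<lambda>x\<in>X. x) ` A = A" if "A \<subseteq> X" for A using that by force
  moreover have "c A \<subseteq> X" if "A \<subseteq> X" for A
    using closure_subset[OF assms that] .
  ultimately show ?thesis by (simp add: continuous_maps_def)
qed

lemma restrict_id_simplicial:
  assumes "simplicial_complex X E"
  shows "(\<lambda>x\<in>X. x) \<in> simplicial_maps X E X E"
proof -
  have "(\<lambda>x\<in>X. x) ` A = A" if "A \<subseteq> X" for A using that by force
  moreover have "\<sigma> \<subseteq> X" if "\<sigma> \<in> E" for \<sigma>
    using assms that by (simp add: simplicial_complex_def)
  ultimately show ?thesis by (simp add: simplicial_maps_def)
qed

lemma compose_restrict_id:
  assumes "f \<in> X \<rightarrow>\<^sub>E Y"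
  shows "compose X f (\<lambda>x\<in>X. x) = f" and "compose X (\<lambda>y\<in>Y. y) f = f"
  using compose_Id[of f X Y] Id_compose[of f X Y] assms by (simp_all add: PiE_def)

lemma category_Cl: "category (Cl U)"
proof
  fix P Q f
  assume "f \<in> hom (Cl U) P Q"
  then have *: "f \<in> fst P \<rightarrow>\<^sub>E fst Q"
    by (cases P; cases Q) (simp add: Cl_def continuous_maps_def)
  show "comp (Cl U) P P Q f (ident (Cl U) P) = f" "comp (Cl U) P Q Q (ident (Cl U) Q) f = f"
    using compose_restrict_id[OF *] by (cases P; cases Q; simp add: Cl_def)+
next
  fix N P Q R f g h
  assume "f \<in> hom (Cl U) N P"
  then have "f \<in> fst N \<rightarrow> fst P"
    by (cases N; cases P) (simp add: Cl_def PiE_def continuous_maps_def)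
  then show "comp (Cl U) N P R (comp (Cl U) P Q R h g) f =
      comp (Cl U) N Q R h (comp (Cl U) N P Q g f)"
    using compose_assoc[of f "fst N" "fst P" h g]
    by (cases N; cases P; cases Q) (simp add: Cl_def)
next
  fix P
  assume "P \<in> obj (Cl U)"
  then show "ident (Cl U) P \<in> hom (Cl U) P P"
    by (cases P) (simp add: Cl_def restrict_id_continuous)
next
  fix P Q R f g
  assume "P \<in> obj (Cl U)" "f \<in> hom (Cl U) P Q" "g \<in> hom (Cl U) Q R"
  then show "comp (Cl U) P Q R g f \<in> hom (Cl U) P R"
    by (cases P; cases Q; cases R) (simp add: Cl_def compose_continuous_maps)
qed

lemma category_Simp: "category (Simp U)"
proof
  fix P Q f
  assume "f \<in> hom (Simp U) P Q"
  then have *: "f \<in> fst P \<rightarrow>\<^sub>E fst Q"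
    by (cases P; cases Q) (simp add: Simp_def simplicial_maps_def)
  show "comp (Simp U) P P Q f (ident (Simp U) P) = f" "comp (Simp U) P Q Q (ident (Simp U) Q) f = f"
    using compose_restrict_id[OF *] by (cases P; cases Q; simp add: Simp_def)+
next
  fix N P Q R f g h
  assume "f \<in> hom (Simp U) N P"
  then have "f \<in> fst N \<rightarrow> fst P"
    by (cases N; cases P) (simp add: Simp_def PiE_def simplicial_maps_def)
  then show "comp (Simp U) N P R (comp (Simp U) P Q R h g) f =
      comp (Simp U) N Q R h (comp (Simp U) N P Q g f)"
    using compose_assoc[of f "fst N" "fst P" h g]
    by (cases N; cases P; cases Q) (simp add: Simp_def)
next
  fix P
  assume "P \<in> obj (Simp U)"
  then show "ident (Simp U) P \<in> hom (Simp U) P P"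
    by (cases P) (simp add: Simp_def restrict_id_simplicial)
next
  fix P Q R f g
  assume "P \<in> obj (Simp U)" "f \<in> hom (Simp U) P Q" "g \<in> hom (Simp U) Q R"
  then show "comp (Simp U) P Q R g f \<in> hom (Simp U) P R"
    by (cases P; cases Q; cases R) (simp add: Simp_def compose_simplicial_maps)
qed

lemma simplicial_complex_cech:
  assumes "closure_space X c"
  shows "simplicial_complex X (cech_complex X c)"
  unfolding simplicial_complex_def
proof (intro conjI ballI allI impI)
  fix x
  assume x: "x \<in> X"
  have "\<forall>A\<subseteq>X. A \<subseteq> c A" using assms unfolding closure_space_def by (elim conjE)
  from this[rule_format, of "{x}"] show "{x} \<in> cech_complex X c"
    using x by (auto simp: cech_complex_def)
next
  fix \<sigma> \<tau>
  assume s: "\<sigma> \<in> cech_complex X c" and t: "\<tau> \<noteq> {}" "\<tau> \<subseteq> \<sigma>"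
  obtain x where "x \<in> X" "\<sigma> \<subseteq> c {x}" "finite \<sigma>" "\<sigma> \<subseteq> X"
    using s by (auto simp: cech_complex_def)
  moreover have "finite \<tau>" using t(2) \<open>finite \<sigma>\<close> by (rule finite_subset)
  moreover have "\<tau> \<subseteq> c {x}" "\<tau> \<subseteq> X"
    using subset_trans[OF t(2)] calculation by simp_all
  ultimately show "\<tau> \<in> cech_complex X c"
    using t(1) by (auto simp: cech_complex_def)
qed (simp_all add: cech_complex_def)

lemma continuous_imp_simplicial:
  assumes "closure_space X c" "f \<in> continuous_maps X c Y d"
  shows "f \<in> simplicial_maps X (cech_complex X c) Y (cech_complex Y d)"
proof -
  have fX: "f \<in> X \<rightarrow>\<^sub>E Y" using continuous_maps_PiE[OF assms(2)] .
  have "f ` \<sigma> \<in> cech_complex Y d" if s: "\<sigma> \<in> cech_complex X c" for \<sigma>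
  proof -
    obtain x where x: "x \<in> X" "\<sigma> \<subseteq> c {x}" using s by (auto simp: cech_complex_def)
    have "f ` c {x} \<subseteq> d (f ` {x})" using assms(2) x unfolding continuous_maps_def by blast
    hence "f ` \<sigma> \<subseteq> d {f x}" using image_mono[OF x(2), of f] by simp
    moreover have "f x \<in> Y" using PiE_mem[OF fX x(1)] .
    moreover have "f ` \<sigma> \<subseteq> Y" using s PiE_mem[OF fX] by (auto simp: cech_complex_def)
    ultimately show ?thesis using s unfolding cech_complex_def by blast
  qed
  thus ?thesis using fX by (simp add: simplicial_maps_def)
qed

lemma functor_Cech: "category_functor (Cl U) (Simp U) Cech"
proof (intro category_functor.intro category_functor_axioms.intro category_Cl category_Simp)
  fix P
  assume "P \<in> obj (Cl U)"
  then show "fobj Cech P \<in> obj (Simp U)"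
    by (cases P) (simp add: Cl_def Simp_def Cech_def simplicial_complex_cech)
next
  fix P Q f
  assume "P \<in> obj (Cl U)" "f \<in> hom (Cl U) P Q"
  then show "fmor Cech P Q f \<in> hom (Simp U) (fobj Cech P) (fobj Cech Q)"
    by (cases P; cases Q) (simp add: Cl_def Simp_def Cech_def continuous_imp_simplicial)
next
  fix P
  show "fmor Cech P P (ident (Cl U) P) = ident (Simp U) (fobj Cech P)"
    by (cases P) (simp add: Cl_def Simp_def Cech_def)
next
  fix P Q R f g
  show "fmor Cech P R (comp (Cl U) P Q R g f) =
      comp (Simp U) (fobj Cech P) (fobj Cech Q) (fobj Cech R) (fmor Cech Q R g) (fmor Cech P Q f)"
    by (cases P) (simp add: Cl_def Simp_def Cech_def)
qed

end

theory Submission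
  imports Defs
begin

text \<open>
  An adjoint would force the Cech functor to preserve colimits or limits; both fail already on
  three points \<open>p, a, b\<close>.  Let \<open>Q = {p, a, b}\<close> with \<open>c(p) = Q\<close> and \<open>a, b\<close> closed.

  Right adjoint: \<open>Q\<close> is the pushout of \<open>{p, a}\<close> and \<open>{p, b}\<close> along \<open>{p}\<close> in \<open>Cl\<close>,
  but its Cech complex is the full triangle, whereas the pushout of the Cech complexes is a path.

  Left adjoint: the discrete space \<open>{a, b}\<close> is the equalizer of two maps out of \<open>Q\<close>, but the
  equalizer of their images in \<open>Simp\<close> contains the edge \<open>{a, b}\<close>.
\<close>

section \<open>Spaces with a distinguished point whose closure is everything\<close>

text \<open>When \<open>p\<close> is not in \<open>X\<close> the test never fires on subsets of
  \<open>X\<close> and the closure is discrete, so one formula covers stars, edges and discrete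
  spaces.\<close>

definition star_closure :: "'u \<Rightarrow> 'u set \<Rightarrow> 'u set \<Rightarrow> 'u set" where
  "star_closure p X = (\<lambda>A\<in>Pow X. if p \<in> A then X else A)"

lemma star_closure_apply:
  "A \<subseteq> X \<Longrightarrow> star_closure p X A = (if p \<in> A then X else A)"
  by (simp add: star_closure_def)

lemma closure_space_star: "closure_space X (star_closure p X)"
  unfolding closure_space_def star_closure_def by (intro conjI allI impI PiE_I) auto

lemma closure_space_mono:
  assumes "closure_space X c" "A \<subseteq> B" "B \<subseteq> X"
  shows "c A \<subseteq> c B"
proof -
  have "c (A \<union> B) = c A \<union> c B"
    using assms by (simp add: closure_space_def)
  moreover have "A \<union> B = B" using assms(2) by blast
  ultimately show ?thesis by auto
qed

text \<open>A set avoiding \<open>p\<close> is closed, so extensivity of \<open>d\<close> suffices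
  for it; a set containing \<open>p\<close> reduces to \<open>{p}\<close> by monotonicity of
  \<open>d\<close>. Only the image of the closure of \<open>p\<close> has to be checked.\<close>

lemma continuous_from_star:
  assumes Y: "closure_space Y d" and f: "f \<in> X \<rightarrow>\<^sub>E Y"
    and p: "p \<in> X \<Longrightarrow> f ` X \<subseteq> d {f p}"
  shows "f \<in> continuous_maps X (star_closure p X) Y d"
proof -
  have "f ` star_closure p X A \<subseteq> d (f ` A)" if A: "A \<subseteq> X" for A
  proof -
    have fA: "f ` A \<subseteq> Y" using f A by auto
    show ?thesis
    proof (cases "p \<in> A")
      case True
      then have "f ` X \<subseteq> d {f p}" using p A by blast
      also have "\<dots> \<subseteq> d (f ` A)"
        by (rule closure_space_mono[OF Y]) (use True fA in auto)
      finally show ?thesis using True A by (simp add: star_closure_apply)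
    next
      case False
      have "f ` A \<subseteq> d (f ` A)" using Y fA by (simp add: closure_space_def)
      then show ?thesis using False A by (simp add: star_closure_apply)
    qed
  qed
  then show ?thesis using f by (simp add: continuous_maps_def)
qed

lemma star_inclusion_continuous:
  "A \<subseteq> X \<Longrightarrow> (\<lambda>x\<in>A. x) \<in> continuous_maps A (star_closure p A) X (star_closure p X)"
  by (rule continuous_from_star[OF closure_space_star]) (auto simp: star_closure_apply subset_iff)

text \<open>The point \<open>p\<close> witnesses every nonempty subset at once, so the complex is a
  full simplex.\<close>

lemma cech_complex_star:
  assumes "p \<in> X" "finite X"
  shows "cech_complex X (star_closure p X) = {\<sigma>. \<sigma> \<noteq> {} \<and> \<sigma> \<subseteq> X}"
  using assms by (auto simp: cech_complex_def star_closure_apply intro: finite_subset[of _ X])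

section \<open>Unfolding rules for the two categories and the functor\<close>

lemma obj_Cl [simp]: "(X, c) \<in> obj (Cl U) \<longleftrightarrow> X \<in> U \<and> closure_space X c"
  by (simp add: Cl_def)

lemma hom_Cl [simp]: "hom (Cl U) (X, c) (Y, d) = continuous_maps X c Y d"
  by (simp add: Cl_def)

lemma comp_Cl [simp]: "comp (Cl U) (X, c) Q R g f = compose X g f"
  by (simp add: Cl_def)

lemma obj_Simp [simp]: "(X, E) \<in> obj (Simp U) \<longleftrightarrow> X \<in> U \<and> simplicial_complex X E"
  by (simp add: Simp_def)

lemma hom_Simp [simp]: "hom (Simp U) (X, E) (Y, F) = simplicial_maps X E Y F"
  by (simp add: Simp_def)

lemma comp_Simp [simp]: "comp (Simp U) (X, E) Q R g f = compose X g f"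
  by (simp add: Simp_def)

lemma fobj_Cech [simp]: "fobj Cech (X, c) = (X, cech_complex X c)"
  by (simp add: Cech_def)

lemma fmor_Cech [simp]: "fmor Cech P Q f = f"
  by (simp add: Cech_def)

section \<open>No right adjoint: gluing two edges at a point\<close>

lemma no_right_adjoint_Cech:
  fixes U :: "'u set set"
  assumes U: "\<And>A :: 'u set. finite A \<Longrightarrow> A \<in> U"
    and distinct: "p \<noteq> a" "p \<noteq> b" "a \<noteq> (b :: 'u)"
  shows "\<not> has_right_adjoint (Cl U) (Simp U) Cech"
proof
  assume "has_right_adjoint (Cl U) (Simp U) Cech"
  then obtain G \<phi> where "adjunction (Cl U) (Simp U) Cech G \<phi>"
    unfolding has_right_adjoint_def by blast
  then interpret adjunction "Cl U" "Simp U" Cech G \<phi> .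
  let ?S = "\<lambda>X. (X, star_closure p X)"
  let ?C = "\<lambda>X. cech_complex X (star_closure p X)"
  let ?in = "\<lambda>X :: 'u set. \<lambda>x\<in>X. x"
  define Q where "Q = {p, a, b}"
  \<comment> \<open>The path with edges \<open>{p, a}\<close> and \<open>{p, b}\<close>; it contains
    neither \<open>{a, b}\<close> nor the triangle \<open>Q\<close>.\<close>
  define K where "K = ?C {p, a} \<union> ?C {p, b}"
  have fin: "finite X" if "X \<subseteq> Q" for X
    using that by (rule finite_subset) (simp add: Q_def)
  have C: "?C X = {\<sigma>. \<sigma> \<noteq> {} \<and> \<sigma> \<subseteq> X}" if "p \<in> X" "X \<subseteq> Q" for X
    using that fin by (intro cech_complex_star)
  have KI: "\<sigma> \<in> K \<longleftrightarrow> \<sigma> \<noteq> {} \<and> (\<sigma> \<subseteq> {p, a} \<or> \<sigma> \<subseteq> {p, b})" for \<sigma>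
    unfolding K_def by (auto simp: C Q_def)
  have K: "(Q, K) \<in> obj (Simp U)"
    unfolding obj_Simp simplicial_complex_def
  proof (intro conjI ballI allI impI)
    show "Q \<in> U" using U fin by blast
  next
    fix \<sigma> assume "\<sigma> \<in> K"
    then show "\<sigma> \<noteq> {}" "\<sigma> \<subseteq> Q" by (auto simp: KI Q_def)
    then show "finite \<sigma>" using fin by blast
  next
    fix x assume "x \<in> Q"
    then show "{x} \<in> K" by (auto simp: KI Q_def)
  next
    fix \<sigma> \<tau> assume "\<sigma> \<in> K" "\<tau> \<noteq> {}" "\<tau> \<subseteq> \<sigma>"
    then show "\<tau> \<in> K" unfolding KI by blast
  qed
  have S: "?S X \<in> obj (Cl U)" if "X \<subseteq> Q" for X
    using U[OF fin[OF that]] by (simp add: closure_space_star)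
  obtain Z e where GK: "fobj G (Q, K) = (Z, e)" by (cases "fobj G (Q, K)")
  have Z: "closure_space Z e"
    using right.fobj_in_obj[OF K] by (simp add: GK)
  have \<phi>_bij: "bij_betw (\<phi> (?S X) (Q, K)) (simplicial_maps X (?C X) Q K)
      (continuous_maps X (star_closure p X) Z e)" if "X \<subseteq> Q" for X
    using bij[OF S[OF that] K] by (simp add: GK)
  \<comment> \<open>Composing with an inclusion is restriction, so naturality in the source makes
    \<open>\<phi>\<close> commute with restriction.\<close>
  have \<phi>_restrict: "\<phi> (?S X) (Q, K) (restrict m X) = restrict (\<phi> (?S Y) (Q, K) m) X"
    if XY: "X \<subseteq> Y" "Y \<subseteq> Q" and m: "m \<in> simplicial_maps Y (?C Y) Q K" for X Y m
  proof -
    have X: "X \<subseteq> Q" using XY by blast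
    have "compose X f (?in X) = restrict f X" for f :: "'u \<Rightarrow> 'u"
      by (auto simp: compose_def)
    then show ?thesis
      using natural_left[OF S[OF XY(2)] S[OF X] K, of "?in X" m] m
        star_inclusion_continuous[OF XY(1), of p]
      by (simp add: GK)
  qed
  have in_K: "?in X \<in> simplicial_maps X (?C X) Q K"
    if "p \<in> X" "X \<subseteq> {p, a} \<or> X \<subseteq> {p, b}" for X
  proof -
    have X: "X \<subseteq> Q" using that by (auto simp: Q_def)
    have "?in X ` \<sigma> \<in> K" if "\<sigma> \<in> ?C X" for \<sigma>
    proof -
      have "\<sigma> \<noteq> {}" "\<sigma> \<subseteq> X" using that C[OF \<open>p \<in> X\<close> X] by auto
      moreover from this have "?in X ` \<sigma> = \<sigma>" by force
      ultimately show ?thesis using \<open>X \<subseteq> {p, a} \<or> X \<subseteq> {p, b}\<close> by (auto simp: KI)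
    qed
    then show ?thesis using X by (auto simp: simplicial_maps_def)
  qed
  \<comment> \<open>The transposes of the two edge inclusions into the path. Both restrict to the
    transpose of the inclusion of \<open>{p}\<close>, so they agree at \<open>p\<close>.\<close>
  define u where "u = \<phi> (?S {p, a}) (Q, K) (?in {p, a})"
  define v where "v = \<phi> (?S {p, b}) (Q, K) (?in {p, b})"
  have u: "u \<in> continuous_maps {p, a} (star_closure p {p, a}) Z e"
    unfolding u_def using bij_betw_apply[OF \<phi>_bij in_K] by (simp add: Q_def)
  have v: "v \<in> continuous_maps {p, b} (star_closure p {p, b}) Z e"
    unfolding v_def using bij_betw_apply[OF \<phi>_bij in_K] by (simp add: Q_def)
  have "restrict u {p} = restrict v {p}"
  proof -
    have "restrict (?in {p, a}) {p} = restrict (?in {p, b}) {p}" by auto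
    then show ?thesis
      unfolding u_def v_def
      using \<phi>_restrict[of "{p}" "{p, a}" "?in {p, a}"] \<phi>_restrict[of "{p}" "{p, b}" "?in {p, b}"]
        in_K[of "{p, a}"] in_K[of "{p, b}"]
      by (simp add: Q_def)
  qed
  then have uv: "u p = v p" by (metis restrict_apply' singletonI)
  have uZ: "u \<in> {p, a} \<rightarrow>\<^sub>E Z" and vZ: "v \<in> {p, b} \<rightarrow>\<^sub>E Z"
    using u v continuous_maps_PiE by blast+
  have ue: "u ` {p, a} \<subseteq> e {u p}" and ve: "v ` {p, b} \<subseteq> e {v p}"
    using u v by (force simp: continuous_maps_def star_closure_apply dest: spec[of _ "{p}"])+
  \<comment> \<open>The map glued from \<open>u\<close> and \<open>v\<close>. It is continuous on
    the whole star because both images lie in the closure of the common value at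
    \<open>p\<close>.\<close>
  define h where "h = (\<lambda>x\<in>Q. if x = b then v b else u x)"
  have h: "h \<in> continuous_maps Q (star_closure p Q) Z e"
  proof (rule continuous_from_star[OF Z])
    show "h \<in> Q \<rightarrow>\<^sub>E Z" using uZ vZ distinct by (auto simp: h_def Q_def)
    show "h ` Q \<subseteq> e {h p}" using ue ve uv distinct by (auto simp: h_def Q_def)
  qed
  have hu: "restrict h {p, a} = u" and hv: "restrict h {p, b} = v"
    using PiE_arb[OF uZ] PiE_arb[OF vZ] distinct uv by (auto simp: h_def Q_def fun_eq_iff)
  \<comment> \<open>By surjectivity of \<open>\<phi>\<close>, \<open>h\<close> is the transpose of a
    simplicial map \<open>m\<close> from the full triangle to the path.\<close>
  from h have "h \<in> \<phi> (?S Q) (Q, K) ` simplicial_maps Q (?C Q) Q K"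
    unfolding bij_betw_imp_surj_on[OF \<phi>_bij[OF subset_refl]] .
  then obtain m where m: "m \<in> simplicial_maps Q (?C Q) Q K" and hm: "\<phi> (?S Q) (Q, K) m = h"
    by (elim imageE) simp
  \<comment> \<open>On each edge, \<open>m\<close> and the inclusion have the same transpose, so
    injectivity of \<open>\<phi>\<close> identifies them.\<close>
  have m_in: "restrict m X = ?in X"
    if X: "p \<in> X" "X \<subseteq> {p, a} \<or> X \<subseteq> {p, b}"
      and hX: "restrict h X = \<phi> (?S X) (Q, K) (?in X)" for X
  proof -
    have XQ: "X \<subseteq> Q" using X by (auto simp: Q_def)
    have "restrict m X \<in> simplicial_maps X (?C X) Q K"
    proof -
      have "\<sigma> \<subseteq> X" "m ` \<sigma> \<in> K" if "\<sigma> \<in> ?C X" for \<sigma>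
      proof -
        have \<sigma>: "\<sigma> \<noteq> {}" "\<sigma> \<subseteq> X" using that C[OF X(1) XQ] by simp_all
        show "\<sigma> \<subseteq> X" by fact
        have "\<sigma> \<in> ?C Q" using \<sigma> XQ X(1) C[of Q] by blast
        then show "m ` \<sigma> \<in> K" using m by (simp add: simplicial_maps_def)
      qed
      moreover have "restrict m X ` \<sigma> = m ` \<sigma>" if "\<sigma> \<subseteq> X" for \<sigma>
        using that by (auto simp: image_restrict_eq Int_absorb1)
      ultimately show ?thesis
        using simplicial_maps_PiE[OF m] XQ by (auto simp: simplicial_maps_def)
    qed
    moreover have "\<phi> (?S X) (Q, K) (restrict m X) = \<phi> (?S X) (Q, K) (?in X)"
      using \<phi>_restrict[OF XQ subset_refl m] hX by (simp add: hm)
    ultimately show ?thesis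
      using bij_betw_imp_inj_on[OF \<phi>_bij[OF XQ]] in_K[OF X] by (auto dest: inj_onD)
  qed
  have "restrict m {p, a} = ?in {p, a}" "restrict m {p, b} = ?in {p, b}"
    using m_in[of "{p, a}"] m_in[of "{p, b}"] hu hv by (simp_all add: u_def v_def)
  then have "m p = p" "m a = a" "m b = b" by (metis insertCI restrict_apply')+
  \<comment> \<open>Since \<open>m\<close> fixes all three vertices, the triangle \<open>Q\<close>
    would be a simplex of the path \<open>K\<close>.\<close>
  then have "m ` Q = Q" by (simp add: Q_def)
  moreover have "m ` Q \<in> K"
  proof -
    have "p \<in> Q" by (simp add: Q_def)
    then have "Q \<in> ?C Q" using C[of Q] by blast
    then show ?thesis using m by (simp add: simplicial_maps_def)
  qed
  moreover have "\<not> Q \<subseteq> {p, a}" "\<not> Q \<subseteq> {p, b}" using distinct by (auto simp: Q_def)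
  ultimately show False by (simp add: KI)
qed

section \<open>No left adjoint: an equalizer that loses an edge\<close>

lemma no_left_adjoint_Cech:
  fixes U :: "'u set set"
  assumes U: "\<And>A :: 'u set. finite A \<Longrightarrow> A \<in> U"
    and distinct: "p \<noteq> a" "p \<noteq> b" "a \<noteq> (b :: 'u)"
  shows "\<not> has_left_adjoint (Cl U) (Simp U) Cech"
proof
  assume "has_left_adjoint (Cl U) (Simp U) Cech"
  then obtain L \<phi> where "adjunction (Simp U) (Cl U) L Cech \<phi>"
    unfolding has_left_adjoint_def by blast
  then interpret adjunction "Simp U" "Cl U" L Cech \<phi> .
  define Q where "Q = {p, a, b}"
  define S where "S = {a, b}"
  \<comment> \<open>\<open>K\<close> is the edge on \<open>{a, b}\<close>, to be tested against the
    discrete space \<open>SS\<close>.\<close>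
  define K where "K = (S, {\<sigma>. \<sigma> \<noteq> {} \<and> \<sigma> \<subseteq> S})"
  define QQ where "QQ = (Q, star_closure p Q)"
  define SS where "SS = (S, star_closure p S)"
  \<comment> \<open>Here \<open>b\<close> has closure \<open>S\<close>, which makes \<open>g\<close>
    continuous although it sends \<open>p\<close> to \<open>b\<close> and the other points to
    \<open>a\<close>. The maps \<open>f\<close> and \<open>g\<close> agree on \<open>Q\<close>
    exactly at the points of \<open>S\<close>.\<close>
  define YY where "YY = (S, star_closure b S)"
  define f where "f = (\<lambda>x\<in>Q. a)"
  define g where "g = (\<lambda>x\<in>Q. if x = p then b else a)"
  define i where "i = (\<lambda>x\<in>S. x)"
  note defs = Q_def S_def
  have K: "K \<in> obj (Simp U)"
    by (auto simp: K_def simplicial_complex_def defs intro!: U intro: finite_subset[of _ "{a, b}"])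
  have QQ: "QQ \<in> obj (Cl U)" and SS: "SS \<in> obj (Cl U)" and YY: "YY \<in> obj (Cl U)"
    by (auto simp: QQ_def SS_def YY_def defs closure_space_star intro!: U)
  have f: "f \<in> hom (Cl U) QQ YY" and g: "g \<in> hom (Cl U) QQ YY"
    using distinct unfolding QQ_def YY_def hom_Cl
    by (auto simp: f_def g_def defs star_closure_apply PiE_iff extensional_def
        split: if_splits intro!: continuous_from_star closure_space_star)
  have i: "i \<in> hom (Cl U) SS QQ"
    unfolding SS_def QQ_def hom_Cl i_def
    by (rule star_inclusion_continuous) (auto simp: defs)
  obtain Z e where LK: "fobj L K = (Z, e)" by (cases "fobj L K")
  have Z: "closure_space Z e"
    using left.fobj_in_obj[OF K] by (simp add: LK)
  \<comment> \<open>The edge \<open>{a, b}\<close> lies in the closure of \<open>p\<close>, a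
    witness outside \<open>S\<close>; this is what passing to the equalizer destroys.\<close>
  have "i \<in> simplicial_maps S (snd K) Q (cech_complex Q (star_closure p Q))"
  proof -
    have "i ` \<sigma> = \<sigma>" if "\<sigma> \<subseteq> S" for \<sigma>
      using that by (force simp: i_def)
    moreover have "cech_complex Q (star_closure p Q) = {\<sigma>. \<sigma> \<noteq> {} \<and> \<sigma> \<subseteq> Q}"
      by (rule cech_complex_star) (simp_all add: Q_def)
    ultimately show ?thesis
      by (auto simp: simplicial_maps_def K_def i_def defs)
  qed
  then have "i \<in> hom (Simp U) K (fobj Cech QQ)"
    by (simp add: K_def QQ_def)
  then have "i \<in> \<phi> K QQ ` hom (Cl U) (fobj L K) QQ"
    unfolding bij_betw_imp_surj_on[OF bij[OF K QQ]] .
  then obtain h where h: "h \<in> hom (Cl U) (fobj L K) QQ" and \<phi>h: "\<phi> K QQ h = i"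
    by (elim imageE) simp
  have h_cont: "h \<in> continuous_maps Z e Q (star_closure p Q)"
    using h by (simp add: LK QQ_def)
  have hPi: "h \<in> Z \<rightarrow>\<^sub>E Q" using continuous_maps_PiE[OF h_cont] .
  have "compose S f i = compose S g i"
    using distinct by (auto simp: compose_def f_def g_def i_def defs)
  \<comment> \<open>Naturality in the target turns \<open>f\<close> after \<open>i\<close> equals
    \<open>g\<close> after \<open>i\<close> into the same equation for \<open>h\<close>, which
    forces \<open>h\<close> to take values in \<open>S\<close>.\<close>
  then have "\<phi> K YY (compose Z f h) = \<phi> K YY (compose Z g h)"
    using natural_right[OF K QQ YY f h] natural_right[OF K QQ YY g h]
    by (simp add: LK \<phi>h) (simp add: K_def)
  moreover have "compose Z k h \<in> hom (Cl U) (fobj L K) YY" if "k \<in> hom (Cl U) QQ YY" for k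
    using left.target.comp_in_hom[OF left.fobj_in_obj[OF K] QQ YY h that] by (simp add: LK)
  ultimately have fg: "compose Z f h = compose Z g h"
    using f g bij_betw_imp_inj_on[OF bij[OF K YY]] by (auto dest: inj_onD)
  have hS: "h z \<in> S" if "z \<in> Z" for z
  proof -
    have "f (h z) = g (h z)" using fun_cong[OF fg, of z] that by (simp add: compose_def)
    moreover have "h z \<in> Q" using hPi that by auto
    ultimately show ?thesis using distinct by (auto simp: f_def g_def defs split: if_splits)
  qed
  \<comment> \<open>On sets avoiding \<open>p\<close> the closures of \<open>Q\<close> and
    \<open>S\<close> coincide, so \<open>h\<close> remains continuous into the discrete
    space.\<close>
  have h': "h \<in> continuous_maps Z e S (star_closure p S)"
  proof -
    have "h ` e A \<subseteq> star_closure p S (h ` A)" if A: "A \<subseteq> Z" for A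
    proof -
      have "h ` A \<subseteq> S" using A hS by auto
      moreover have "h ` e A \<subseteq> star_closure p Q (h ` A)"
        using h_cont A by (simp add: continuous_maps_def)
      moreover have "p \<notin> S" "S \<subseteq> Q" using distinct by (auto simp: defs)
      ultimately have "star_closure p Q (h ` A) = star_closure p S (h ` A)"
        using star_closure_apply[of "h ` A" Q p] star_closure_apply[of "h ` A" S p] by auto
      then show ?thesis
        using \<open>h ` e A \<subseteq> star_closure p Q (h ` A)\<close> by simp
    qed
    then show ?thesis using hPi hS by (auto simp: continuous_maps_def PiE_iff)
  qed
  then have h'_hom: "h \<in> hom (Cl U) (fobj L K) SS" by (simp add: LK SS_def)
  define k where "k = \<phi> K SS h"
  have k: "k \<in> simplicial_maps S (snd K) S (cech_complex S (star_closure p S))"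
    using bij_betw_apply[OF bij[OF K SS] h'_hom] by (simp add: k_def K_def SS_def)
  have "compose Z i h = h"
    unfolding i_def using compose_restrict_id(2)[OF continuous_maps_PiE[OF h']] .
  \<comment> \<open>Naturality along \<open>i\<close> factors \<open>i\<close> through the transpose
    \<open>k\<close>; as \<open>i\<close> is the identity on points, \<open>k\<close> must be
    \<open>i\<close>.\<close>
  then have "i = compose S i k"
    using natural_right[OF K SS QQ i h'_hom] \<phi>h by (simp add: LK k_def) (simp add: K_def)
  also have "\<dots> = k"
    unfolding i_def using compose_restrict_id(2)[OF simplicial_maps_PiE[OF k]] .
  finally have ik: "i = k" .
  \<comment> \<open>Now the edge \<open>S\<close> would be a simplex over a discrete space, hence
    contained in a single point.\<close>
  have "S \<in> snd K" by (simp add: K_def S_def)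
  then have "i ` S \<in> cech_complex S (star_closure p S)"
    using k unfolding ik simplicial_maps_def by blast
  moreover have "i ` S = S" by (auto simp: i_def)
  ultimately have "S \<in> cech_complex S (star_closure p S)" by simp
  then obtain x where x: "x \<in> S" "S \<subseteq> star_closure p S {x}"
    unfolding cech_complex_def by blast
  moreover have "x \<noteq> p" using distinct x(1) by (auto simp: S_def)
  ultimately have "S \<subseteq> {x}" by (simp add: star_closure_apply)
  then show False using distinct(3) by (auto simp: S_def)
qed

theorem theorem6p15:
  fixes U :: "'u set set"
  assumes "infinite (UNIV :: 'u set)"
    and "\<And>A :: 'u set. finite A \<Longrightarrow> A \<in> U"
  shows "\<not> has_right_adjoint (Cl U) (Simp U) Cech \<and> \<not> has_left_adjoint (Cl U) (Simp U) Cech"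
proof -
  \<comment> \<open>Both obstructions live on three distinct points, which the infinite type
    supplies.\<close>
  obtain T :: "'u set" where "card T = 3"
    using infinite_arbitrarily_large[OF assms(1)] by blast
  then obtain p a b :: 'u where "p \<noteq> a" "p \<noteq> b" "a \<noteq> b"
    by (auto simp: card_3_iff)
  then show ?thesis
    using no_right_adjoint_Cech[OF assms(2)] no_left_adjoint_Cech[OF assms(2)] by blast
qed

end
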